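(* Let $M$ be the extended phase space with coordinates $(\mathbf{x},t)=(x,y,z,t)$, and let $(\mathbf{u},\rho,q,\eta)$ be a tuple consisting of a smooth velocity field $\mathbf{u}(\mathbf{x},t)$ with three components, a smooth positive scalar function $\rho(\mathbf{x},t)>0$, and two smooth scalar functions $q(\mathbf{x},t)$, $\eta(\mathbf{x},t)$ on $M$. Write $D_t:=\partial_t+\mathbf{u}\cdot\nabla$. Suppose that $$D_t\rho+\rho\,(\nabla\cdot\mathbf{u})=0,\qquad D_t q=0,\qquad D_t\eta=0$$ on $M$. Then the vector field $L_{q,\eta}$ on $M$ defined by $$L_{q,\eta}:=\left(\rho^{-1}\,\nabla q\times\nabla\eta\right)\cdot\nabla$$ satisfies $[D_t,L_{q,\eta}]=0$. In particular, if $\nabla q$ and $\nabla\eta$ are linearly independent except possibly on a set of measure zero in $M$, then $(D_t,L_{q,\eta},q,\eta)$ is an integrable system of type $(2,2)$ on $M$.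
   Context: All functions and vector fields are assumed smooth. The extended phase space $M$ is $\mathbb{R}^4$ with coordinates $(x,y,z,t)$, or the quotient obtained when some of these coordinates are taken to be periodic (each factor being $\mathbb{R}$ or a circle). The symbol $\nabla=(\partial_x,\partial_y,\partial_z)$ denotes the spatial gradient. Vector fields are identified with first-order differential operators, and $[X,Y](f):=X(Y(f))-Y(X(f))$ for all smooth scalar functions $f$. Definition (integrable system of type $(p,r)$). Let $M$ be a manifold, $p\ge 1$, $r\ge 0$, $p+r=\dim M$. Vector fields $X_1,\dots,X_p$ and functions $F_1,\dots,F_r$ on $M$ form an integrable system $(X_1,\dots,X_p,F_1,\dots,F_r)$ of type $(p,r)$ if: (1) $[X_i,X_j]=0$ for all $i,j$; (2) $X_i(F_j)=0$ for all $i,j$; (3) $X_1,\dots,X_p$ are linearly independent at all points of $M$ except possibly on a set of measure zero; (4) the differentials (gradients on $M$) of $F_1,\dots,F_r$ are linearly independent at all points of $M$ except possibly on a set of measure zero. *)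

theory Defs
  imports "HOL-Analysis.Analysis"
begin

text \<open>
  A phase space is a Euclidean space (such as \<open>\<real>\<^sup>3 \<times> \<real>\<close>, with points \<open>(x, t)\<close>) in which the
  coordinates \<open>b \<in> C \<subseteq> Basis\<close> are periodic with period \<open>T b > 0\<close>. It is the quotient \<open>M\<close> of the
  Euclidean space by the lattice generated by the vectors \<open>T b *\<^sub>R b\<close>. Functions on \<open>M\<close> are
  identified with their pullbacks to the Euclidean space, i.e. with the functions invariant
  under these translations; \<open>C = {}\<close> means that no coordinate is periodic.
\<close>

definition periodic_coords :: "'a::euclidean_space set \<Rightarrow> ('a \<Rightarrow> real) \<Rightarrow> bool" where
  "periodic_coords C T \<longleftrightarrow> C \<subseteq> Basis \<and> (\<forall>b\<in>C. T b > 0)"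

primrec times_differentiable ::
  "nat \<Rightarrow> ('a::real_normed_vector \<Rightarrow> 'b::real_normed_vector) \<Rightarrow> bool" where
  "times_differentiable 0 f \<longleftrightarrow> continuous_on UNIV f"
| "times_differentiable (Suc n) f \<longleftrightarrow>
     (\<forall>p. f differentiable (at p)) \<and>
     (\<forall>v. times_differentiable n (\<lambda>p. frechet_derivative f (at p) v))"

text \<open>
  The following covers scalar functions and also vector fields on \<open>M\<close>, the latter being given by
  their components: the translations act trivially on tangent vectors.
\<close>

definition smooth_on_space ::
  "'a::euclidean_space set \<Rightarrow> ('a \<Rightarrow> real) \<Rightarrow> ('a \<Rightarrow> 'b::real_normed_vector) \<Rightarrow> bool" where
  "smooth_on_space C T f \<longleftrightarrow>
     (\<forall>n. times_differentiable n f) \<and> (\<forall>b\<in>C. \<forall>p. f (p + T b *\<^sub>R b) = f p)"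

text \<open>
  The first-order operator \<open>\<Sum>b\<in>Basis. a\<^sub>b \<partial>\<^sub>b\<close> is represented by \<open>X p = (\<Sum>b\<in>Basis. a\<^sub>b p *\<^sub>R b)\<close>; its
  action on a function is differentiation along \<open>X\<close>.
\<close>

definition vf_apply :: "('a::euclidean_space \<Rightarrow> 'a) \<Rightarrow> ('a \<Rightarrow> real) \<Rightarrow> 'a \<Rightarrow> real" where
  "vf_apply X f p = frechet_derivative f (at p) (X p)"

definition lie_bracket ::
  "('a::euclidean_space \<Rightarrow> 'a) \<Rightarrow> ('a \<Rightarrow> 'a) \<Rightarrow> ('a \<Rightarrow> real) \<Rightarrow> 'a \<Rightarrow> real" where
  "lie_bracket X Y f p = vf_apply X (vf_apply Y f) p - vf_apply Y (vf_apply X f) p"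

definition commuting ::
  "'a::euclidean_space set \<Rightarrow> ('a \<Rightarrow> real) \<Rightarrow> ('a \<Rightarrow> 'a) \<Rightarrow> ('a \<Rightarrow> 'a) \<Rightarrow> bool" where
  "commuting C T X Y \<longleftrightarrow>
     (\<forall>f. smooth_on_space C T f \<longrightarrow> (\<forall>p. lie_bracket X Y f p = 0))"

definition full_gradient :: "('a::euclidean_space \<Rightarrow> real) \<Rightarrow> 'a \<Rightarrow> 'a" where
  "full_gradient f p = (\<Sum>b\<in>Basis. frechet_derivative f (at p) b *\<^sub>R b)"

definition lin_indep :: "'a::real_vector list \<Rightarrow> bool" where
  "lin_indep vs \<longleftrightarrow> distinct vs \<and> independent (set vs)"

text \<open>
  A subset of \<open>M\<close> has measure zero iff its preimage in the Euclidean space does, so exceptional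
  sets are measured there.
\<close>

definition integrable_system ::
  "'a::euclidean_space set \<Rightarrow> ('a \<Rightarrow> real) \<Rightarrow> nat \<Rightarrow> nat \<Rightarrow> ('a \<Rightarrow> 'a) list \<Rightarrow> ('a \<Rightarrow> real) list \<Rightarrow> bool"
  where
  "integrable_system C T p r Xs Fs \<longleftrightarrow>
     p \<ge> 1 \<and> p + r = DIM('a) \<and> length Xs = p \<and> length Fs = r \<and>
     (\<forall>X\<in>set Xs. smooth_on_space C T X) \<and> (\<forall>F\<in>set Fs. smooth_on_space C T F) \<and>
     (\<forall>X\<in>set Xs. \<forall>Y\<in>set Xs. commuting C T X Y) \<and>
     (\<forall>X\<in>set Xs. \<forall>F\<in>set Fs. \<forall>m. vf_apply X F m = 0) \<and>
     negligible {m. \<not> lin_indep (map (\<lambda>X. X m) Xs)} \<and>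
     negligible {m. \<not> lin_indep (map (\<lambda>F. full_gradient F m) Fs)}"

type_synonym spacetime = "(real^3) \<times> real"

definition spatial_gradient :: "(spacetime \<Rightarrow> real) \<Rightarrow> spacetime \<Rightarrow> real^3" where
  "spatial_gradient f p = (\<chi> i. frechet_derivative f (at p) (axis i 1, 0))"

definition spatial_divergence :: "(spacetime \<Rightarrow> real^3) \<Rightarrow> spacetime \<Rightarrow> real" where
  "spatial_divergence u p = (\<Sum>i\<in>UNIV. frechet_derivative (\<lambda>m. u m $ i) (at p) (axis i 1, 0))"

text \<open>The vector field \<open>\<partial>\<^sub>t + u \<cdot> \<nabla>\<close>.\<close>

definition material_field :: "(spacetime \<Rightarrow> real^3) \<Rightarrow> spacetime \<Rightarrow> spacetime" where
  "material_field u p = (u p, 1)"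

text \<open>The vector field \<open>(\<rho>\<inverse> \<nabla>q \<times> \<nabla>\<eta>) \<cdot> \<nabla>\<close>, which has no \<open>\<partial>\<^sub>t\<close> component.\<close>

definition L_field ::
  "(spacetime \<Rightarrow> real) \<Rightarrow> (spacetime \<Rightarrow> real) \<Rightarrow> (spacetime \<Rightarrow> real) \<Rightarrow> spacetime \<Rightarrow> spacetime" where
  "L_field \<rho> q \<eta> p =
     (inverse (\<rho> p) *\<^sub>R cross3 (spatial_gradient q p) (spatial_gradient \<eta> p), 0)"

end

theory Submission
  imports Defs
begin

text \<open>
  Since second derivatives commute, the bracket of two vector fields acts on functions as the
  vector field \<open>DY X - DX Y\<close>. For \<open>X = \<partial>\<^sub>t + u \<cdot> \<nabla>\<close>, a conserved quantity \<open>q\<close> satisfies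
  \<open>D\<^sub>t \<nabla>q = - (\<nabla>u)\<^sup>T \<nabla>q\<close>, so the identity \<open>A\<^sup>T a \<times> b + a \<times> A\<^sup>T b = tr A (a \<times> b) - A (a \<times> b)\<close>
  turns the product rule for \<open>w = \<rho>\<inverse> \<nabla>q \<times> \<nabla>\<eta>\<close> into \<open>D\<^sub>t w = (w \<cdot> \<nabla>) u\<close>: the trace term is
  absorbed by the continuity equation.
\<close>

subsection \<open>Smoothness\<close>

lemma times_differentiable_continuous:
  "times_differentiable n f \<Longrightarrow> continuous_on UNIV f"
  by (cases n)
    (simp_all add: differentiable_imp_continuous_on differentiable_at_imp_differentiable_on)

lemma times_differentiable_Suc_imp:
  "times_differentiable (Suc n) f \<Longrightarrow> times_differentiable n f"
proof (induction n arbitrary: f)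
  case 0
  from times_differentiable_continuous[OF 0] show ?case by simp
next
  case (Suc n)
  then have "times_differentiable (Suc n) (\<lambda>p. frechet_derivative f (at p) v)" for v
    \<comment> \<open>The definition is unfolded at one place only, so that the inner
      \<open>Suc n\<close> stays folded and matches the induction hypothesis.\<close>
    by (subst (asm) (2) times_differentiable.simps(2)) blast
  from this[THEN Suc.IH] Suc.prems show ?case by simp
qed

text \<open>Uniqueness of the derivative allows any explicit formula \<open>f'\<close> in place of
  \<open>frechet_derivative\<close>. The closure properties below are then inductions in which the
  usual differentiation rules supply \<open>f'\<close>.\<close>

lemma times_differentiable_SucI:
  assumes "\<And>p. (f has_derivative f' p) (at p)"
    and "\<And>v. times_differentiable n (\<lambda>p. f' p v)"
  shows "times_differentiable (Suc n) f"
proof -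
  have "frechet_derivative f (at p) = f' p" for p
    using assms(1) frechet_derivative_at by metis
  with assms show ?thesis
    by (auto simp: differentiable_def)
qed

lemma times_differentiable_SucD:
  assumes "times_differentiable (Suc n) f"
  shows "(f has_derivative frechet_derivative f (at p)) (at p)"
    and "times_differentiable n (\<lambda>p. frechet_derivative f (at p) v)"
  using assms by (auto simp: frechet_derivative_works)

lemma times_differentiable_const: "times_differentiable n (\<lambda>p. c)"
proof (induction n arbitrary: c)
  case (Suc n)
  show ?case by (rule times_differentiable_SucI[where f' = "\<lambda>p h. 0"]) (use Suc in auto)
qed simp

lemma times_differentiable_add:
  assumes "times_differentiable n f" "times_differentiable n g"
  shows "times_differentiable n (\<lambda>p. f p + g p)"
  using assms
proof (induction n arbitrary: f g)
  case 0
  then show ?case by (auto intro: continuous_intros)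
next
  case (Suc n)
  show ?case
    by (rule times_differentiable_SucI, rule has_derivative_add)
      (use Suc.prems in \<open>auto intro!: Suc.IH times_differentiable_SucD(2) simp: frechet_derivative_works\<close>)
qed

lemma times_differentiable_sum:
  assumes "\<And>i. i \<in> I \<Longrightarrow> times_differentiable n (f i)"
  shows "times_differentiable n (\<lambda>p. \<Sum>i\<in>I. f i p)"
  using assms
  by (induction I rule: infinite_finite_induct)
    (auto intro: times_differentiable_add times_differentiable_const)

lemma (in bounded_linear) times_differentiable:
  assumes "times_differentiable n g"
  shows "times_differentiable n (\<lambda>p. f (g p))"
  using assms
proof (induction n arbitrary: g)
  case 0
  then show ?case by (auto intro: continuous_on)
next
  case (Suc n)
  show ?case
    by (rule times_differentiable_SucI, rule has_derivative, rule times_differentiable_SucD(1))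
      (use Suc in auto)
qed

lemma (in bounded_bilinear) times_differentiable:
  assumes "times_differentiable n f" "times_differentiable n g"
  shows "times_differentiable n (\<lambda>p. prod (f p) (g p))"
  using assms
proof (induction n arbitrary: f g)
  case 0
  then show ?case by (auto intro: continuous_on)
next
  case (Suc n)
  \<comment> \<open>Each term of the product rule leaves one factor undifferentiated, so the
    induction hypothesis is also applied to \<open>f\<close> and \<open>g\<close> themselves, one
    order lower.\<close>
  note lower = Suc.prems[THEN times_differentiable_Suc_imp]
  show ?case
    by (rule times_differentiable_SucI, rule FDERIV)
      (use Suc.prems lower in \<open>auto intro!: times_differentiable_add Suc.IH simp: frechet_derivative_works\<close>)
qed

lemma times_differentiable_inverse:
  fixes r :: "'a::real_normed_vector \<Rightarrow> real"
  assumes "times_differentiable n r" "\<And>p. r p \<noteq> 0"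
  shows "times_differentiable n (\<lambda>p. inverse (r p))"
  using assms(1)
proof (induction n)
  case 0
  then show ?case using assms(2) by (auto intro: continuous_intros)
next
  case (Suc n)
  \<comment> \<open>The derivative of \<open>inverse (r p)\<close> contains
    \<open>inverse (r p)\<close> again; the induction hypothesis for the same \<open>r\<close>
    controls it up to order \<open>n\<close>.\<close>
  note inv = Suc.IH[OF times_differentiable_Suc_imp[OF Suc.prems]]
  show ?case
  proof (rule times_differentiable_SucI)
    show "((\<lambda>p. inverse (r p)) has_derivative
        (\<lambda>h. - (inverse (r p) * frechet_derivative r (at p) h * inverse (r p)))) (at p)" for p
      using assms(2) times_differentiable_SucD(1)[OF Suc.prems] by (intro Deriv.has_derivative_inverse)
    show "times_differentiable n
        (\<lambda>p. - (inverse (r p) * frechet_derivative r (at p) v * inverse (r p)))" for v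
      using inv Suc.prems
      by (intro bounded_linear.times_differentiable[OF bounded_linear_minus[OF bounded_linear_ident]]
          bounded_bilinear.times_differentiable[OF bounded_bilinear_mult]) auto
  qed
qed

lemma times_differentiable_Pair:
  assumes "times_differentiable n f" "times_differentiable n g"
  shows "times_differentiable n (\<lambda>p. (f p, g p))"
  using assms
proof (induction n arbitrary: f g)
  case 0
  then show ?case by (auto intro: continuous_intros)
next
  case (Suc n)
  show ?case
    by (rule times_differentiable_SucI, rule has_derivative_Pair)
      (use Suc.prems in \<open>auto intro!: Suc.IH simp: frechet_derivative_works\<close>)
qed

lemma smooth_has_derivative:
  assumes "smooth_on_space C T f"
  shows "(f has_derivative frechet_derivative f (at p)) (at p)"
  by (rule times_differentiable_SucD(1)[of 0]) (use assms in \<open>simp only: smooth_on_space_def\<close>)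

text \<open>A translation has the identity as its derivative, so the chain rule computes the
  derivative of \<open>f\<close> at \<open>p\<close> as the one at \<open>p + c\<close>.\<close>

lemma frechet_derivative_periodic:
  assumes "\<And>p. f (p + c) = f p" and "\<And>p. f differentiable (at p)"
  shows "frechet_derivative f (at (p + c)) = frechet_derivative f (at p)"
proof -
  have "((\<lambda>x. x + c) has_derivative (\<lambda>h. h)) (at p)"
    by (auto intro!: derivative_eq_intros)
  moreover have "(f has_derivative frechet_derivative f (at (p + c))) (at (p + c))"
    using assms(2) by (simp only: frechet_derivative_works)
  ultimately have "((\<lambda>x. f (x + c)) has_derivative (\<lambda>h. frechet_derivative f (at (p + c)) h)) (at p)"
    by (rule has_derivative_compose)
  then have "(f has_derivative frechet_derivative f (at (p + c))) (at p)"
    by (simp only: assms(1))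
  then show ?thesis
    by (rule frechet_derivative_at)
qed

lemma smooth_frechet_derivative:
  assumes "smooth_on_space C T f"
  shows "smooth_on_space C T (\<lambda>p. frechet_derivative f (at p) v)"
proof -
  have "f differentiable (at p)" for p
    using smooth_has_derivative[OF assms] by (rule differentiableI)
  then have "frechet_derivative f (at (p + T b *\<^sub>R b)) = frechet_derivative f (at p)" if "b \<in> C" for b p
    using assms that by (intro frechet_derivative_periodic) (simp_all add: smooth_on_space_def)
  moreover have "times_differentiable n (\<lambda>p. frechet_derivative f (at p) v)" for n
    by (rule times_differentiable_SucD(2)) (use assms in \<open>simp only: smooth_on_space_def\<close>)
  ultimately show ?thesis
    by (simp add: smooth_on_space_def)
qed

subsection \<open>Brackets\<close>

text \<open>The mean value theorem is applied twice: first along \<open>v\<close> to the increment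
  of \<open>f\<close> in direction \<open>w\<close>, then along \<open>w\<close> to the derivative
  in direction \<open>v\<close>. The left-hand side is symmetric in \<open>v\<close> and
  \<open>w\<close>, which is what makes mixed derivatives comparable.\<close>

lemma second_difference_mean_value:
  fixes f :: "'a::real_normed_vector \<Rightarrow> real"
  assumes f: "times_differentiable 2 f" and s: "s > 0"
  obtains a b where "0 < a" "a < s" "0 < b" "b < s"
    and "f (p + s *\<^sub>R v + s *\<^sub>R w) - f (p + s *\<^sub>R v) - f (p + s *\<^sub>R w) + f p =
      s\<^sup>2 * frechet_derivative (\<lambda>x. frechet_derivative f (at x) v) (at (p + a *\<^sub>R v + b *\<^sub>R w)) w"
proof -
  let ?F = "\<lambda>x. frechet_derivative f (at x) v"
  have f1: "(f has_derivative frechet_derivative f (at x)) (at x)"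
    and F1: "(?F has_derivative frechet_derivative ?F (at x)) (at x)" for x
    using f by (auto simp: numeral_2_eq_2 frechet_derivative_works)
  have line: "((\<lambda>a. g (x + a *\<^sub>R d)) has_real_derivative g' (x + a *\<^sub>R d) d) (at a)"
    if "\<And>x. (g has_derivative g' x) (at x)" for g :: "'a \<Rightarrow> real" and g' x d a
  proof -
    have "((\<lambda>a. g (x + a *\<^sub>R d)) has_derivative (\<lambda>h. g' (x + a *\<^sub>R d) (h *\<^sub>R d))) (at a)"
      by (rule has_derivative_compose[OF _ that]) (auto intro!: derivative_eq_intros)
    then show ?thesis
      using linear_scale[OF has_derivative_linear[OF that]]
      by (simp add: has_field_derivative_def mult_commute_abs)
  qed
  \<comment> \<open>The second difference is \<open>?g s - ?g 0\<close>.\<close>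
  let ?g = "\<lambda>a. f (p + s *\<^sub>R w + a *\<^sub>R v) - f (p + a *\<^sub>R v)"
  obtain a where a: "0 < a" "a < s"
    "?g s - ?g 0 = (s - 0) * (?F (p + s *\<^sub>R w + a *\<^sub>R v) - ?F (p + a *\<^sub>R v))"
    using MVT2[of 0 s ?g "\<lambda>a. ?F (p + s *\<^sub>R w + a *\<^sub>R v) - ?F (p + a *\<^sub>R v)"] s
      DERIV_diff[OF line[OF f1] line[OF f1]] by blast
  obtain b where b: "0 < b" "b < s"
    "?F (p + a *\<^sub>R v + s *\<^sub>R w) - ?F (p + a *\<^sub>R v + 0 *\<^sub>R w) =
      (s - 0) * frechet_derivative ?F (at (p + a *\<^sub>R v + b *\<^sub>R w)) w"
    using MVT2[of 0 s "\<lambda>b. ?F (p + a *\<^sub>R v + b *\<^sub>R w)"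
        "\<lambda>b. frechet_derivative ?F (at (p + a *\<^sub>R v + b *\<^sub>R w)) w"] s line[OF F1] by blast
  show thesis
    using a b by (intro that[of a b]) (auto simp: power2_eq_square algebra_simps)
qed

text \<open>Schwarz's theorem: for small steps the same second difference equals
  \<open>s\<^sup>2\<close> times either mixed derivative, each taken at some point near
  \<open>p\<close>. Continuity excludes a gap between the two values at \<open>p\<close>.\<close>

lemma frechet_derivative_commute:
  fixes f :: "'a::real_normed_vector \<Rightarrow> real"
  assumes f: "times_differentiable 2 f"
  shows "frechet_derivative (\<lambda>x. frechet_derivative f (at x) v) (at p) w =
    frechet_derivative (\<lambda>x. frechet_derivative f (at x) w) (at p) v" (is "?G p = ?H p")
proof (rule ccontr)
  assume neq: "?G p \<noteq> ?H p"
  \<comment> \<open>With half the gap as tolerance, a number strictly within \<open>e\<close> of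
    \<open>?G p\<close> cannot also be strictly within \<open>e\<close> of
    \<open>?H p\<close>.\<close>
  define e where "e = \<bar>?G p - ?H p\<bar> / 2"
  have "continuous_on UNIV ?G" "continuous_on UNIV ?H"
    using f by (auto simp: numeral_2_eq_2)
  moreover have "e > 0" using neq by (simp add: e_def)
  ultimately have "\<exists>d>0. \<forall>x. dist x p < d \<longrightarrow> dist (?G x) (?G p) < e"
    and "\<exists>d>0. \<forall>x. dist x p < d \<longrightarrow> dist (?H x) (?H p) < e"
    by (simp_all only: continuous_on_iff UNIV_I ball_simps)
  then obtain d1 d2 where d: "d1 > 0" "d2 > 0"
    and G: "\<And>x. dist x p < d1 \<Longrightarrow> dist (?G x) (?G p) < e"
    and H: "\<And>x. dist x p < d2 \<Longrightarrow> dist (?H x) (?H p) < e"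
    by blast
  \<comment> \<open>The summand 1 keeps \<open>N\<close> positive when both directions vanish, and
    makes the final estimate in \<open>near\<close> strict.\<close>
  define N where "N = norm v + norm w + 1"
  have N: "N > 0" unfolding N_def by (simp add: add_nonneg_pos)
  define s where "s = min d1 d2 / N"
  have s: "s > 0" "s * N = min d1 d2"
    using d N by (auto simp: s_def)
  have near: "dist (p + a *\<^sub>R v + b *\<^sub>R w) p < min d1 d2"
    if "0 < a" "a < s" "0 < b" "b < s" for a b
  proof -
    have "dist (p + a *\<^sub>R v + b *\<^sub>R w) p \<le> norm (a *\<^sub>R v) + norm (b *\<^sub>R w)"
      using norm_triangle_ineq[of "a *\<^sub>R v" "b *\<^sub>R w"] by (simp add: dist_norm add.assoc)
    also have "\<dots> \<le> s * norm v + s * norm w"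
      using that by (intro add_mono) (auto intro: mult_right_mono)
    also have "\<dots> < s * N"
      using s(1) by (simp add: N_def algebra_simps)
    finally show ?thesis by (simp only: s(2))
  qed
  obtain a b where ab: "0 < a" "a < s" "0 < b" "b < s"
    and 1: "f (p + s *\<^sub>R v + s *\<^sub>R w) - f (p + s *\<^sub>R v) - f (p + s *\<^sub>R w) + f p =
      s\<^sup>2 * ?G (p + a *\<^sub>R v + b *\<^sub>R w)"
    by (rule second_difference_mean_value[OF f s(1)])
  obtain a' b' where ab': "0 < a'" "a' < s" "0 < b'" "b' < s"
    and 2: "f (p + s *\<^sub>R w + s *\<^sub>R v) - f (p + s *\<^sub>R w) - f (p + s *\<^sub>R v) + f p =
      s\<^sup>2 * ?H (p + a' *\<^sub>R w + b' *\<^sub>R v)"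
    by (rule second_difference_mean_value[OF f s(1)])
  \<comment> \<open>The two second differences agree; the point in \<open>?H\<close> is rewritten
    with \<open>v\<close> first so that \<open>near\<close> applies to it.\<close>
  have "s\<^sup>2 * ?G (p + a *\<^sub>R v + b *\<^sub>R w) = s\<^sup>2 * ?H (p + b' *\<^sub>R v + a' *\<^sub>R w)"
    using 1 2 by (simp add: algebra_simps)
  then have "?G (p + a *\<^sub>R v + b *\<^sub>R w) = ?H (p + b' *\<^sub>R v + a' *\<^sub>R w)"
    using s by simp
  moreover have "dist (?G (p + a *\<^sub>R v + b *\<^sub>R w)) (?G p) < e"
    using near[OF ab] by (intro G) simp
  moreover have "dist (?H (p + b' *\<^sub>R v + a' *\<^sub>R w)) (?H p) < e"
    using near[of b' a'] ab' by (intro H) simp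
  ultimately show False
    by (auto simp: e_def dist_real_def abs_if split: if_splits)
qed

lemma linear_basis_expansion:
  fixes g :: "'a::euclidean_space \<Rightarrow> 'b::real_vector"
  assumes "linear g"
  shows "g x = (\<Sum>b\<in>Basis. (x \<bullet> b) *\<^sub>R g b)"
  using linear_sum[OF assms, of "\<lambda>b. (x \<bullet> b) *\<^sub>R b" Basis]
  by (simp add: euclidean_representation linear_scale[OF assms])

text \<open>Expanding \<open>Y\<close> in the basis separates the two ways in which
  \<open>Y f\<close> depends on the point, and the product rule applies to each summand. Symmetry of
  second derivatives moves \<open>h\<close> inside and leaves \<open>Y p\<close> as the outer
  direction, where the basis sum can be reassembled.\<close>

lemma vf_apply_has_derivative:
  fixes f :: "'a::euclidean_space \<Rightarrow> real"
  assumes f: "times_differentiable 2 f" and Y: "(Y has_derivative Y') (at p)"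
  shows "(vf_apply Y f has_derivative
    (\<lambda>h. frechet_derivative f (at p) (Y' h) +
      frechet_derivative (\<lambda>x. frechet_derivative f (at x) h) (at p) (Y p))) (at p)"
proof -
  let ?D = "\<lambda>v x. frechet_derivative f (at x) v"
  have f1: "(f has_derivative frechet_derivative f (at x)) (at x)"
    and D: "(?D v has_derivative frechet_derivative (?D v) (at x)) (at x)" for v x
    using f by (auto simp: numeral_2_eq_2 frechet_derivative_works)
  note lin = has_derivative_linear[OF f1] and linD = has_derivative_linear[OF D]
  have "vf_apply Y f = (\<lambda>x. \<Sum>b\<in>Basis. (Y x \<bullet> b) * ?D b x)"
    by (simp add: vf_apply_def fun_eq_iff linear_basis_expansion[OF lin, of _ "Y _"])
  moreover have "((\<lambda>x. \<Sum>b\<in>Basis. (Y x \<bullet> b) * ?D b x) has_derivative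
      (\<lambda>h. \<Sum>b\<in>Basis. (Y p \<bullet> b) * frechet_derivative (?D b) (at p) h + (Y' h \<bullet> b) * ?D b p)) (at p)"
    by (intro has_derivative_sum has_derivative_mult has_derivative_inner_left Y D)
  moreover have "(\<Sum>b\<in>Basis. (Y p \<bullet> b) * frechet_derivative (?D b) (at p) h + (Y' h \<bullet> b) * ?D b p)
      = ?D (Y' h) p + frechet_derivative (?D h) (at p) (Y p)" for h
    by (subst linear_basis_expansion[OF lin, of p "Y' h"],
        subst linear_basis_expansion[OF linD, of h p "Y p"],
        subst frechet_derivative_commute[OF f, of _ p h])
      (simp add: sum.distrib)
  ultimately show ?thesis by simp
qed

text \<open>The second-order terms of \<open>X (Y f)\<close> and \<open>Y (X f)\<close> are the
  second derivative of \<open>f\<close> in the directions \<open>X p\<close> and \<open>Y p\<close>,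
  in opposite orders, and cancel.\<close>

lemma lie_bracket_eq:
  fixes f :: "'a::euclidean_space \<Rightarrow> real"
  assumes f: "times_differentiable 2 f"
    and X: "(X has_derivative X') (at p)" and Y: "(Y has_derivative Y') (at p)"
  shows "lie_bracket X Y f p = frechet_derivative f (at p) (Y' (X p) - X' (Y p))"
proof -
  have "linear (frechet_derivative f (at p))"
    using f by (intro has_derivative_linear[of f _ "at p"])
      (auto simp: numeral_2_eq_2 frechet_derivative_works)
  then show ?thesis
    unfolding lie_bracket_def vf_apply_def[of X "vf_apply Y f"] vf_apply_def[of Y "vf_apply X f"]
    using frechet_derivative_commute[OF f, of "X p" p "Y p"]
    by (simp add: frechet_derivative_at[OF vf_apply_has_derivative[OF f X], symmetric]
        frechet_derivative_at[OF vf_apply_has_derivative[OF f Y], symmetric] linear_diff)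
qed

lemma commuting_refl: "commuting C T X X"
  by (simp add: commuting_def lie_bracket_def)

lemma commuting_sym: "commuting C T X Y \<Longrightarrow> commuting C T Y X"
  by (simp add: commuting_def lie_bracket_def)

subsection \<open>Linear algebra in three dimensions\<close>

lemma lin_indep_2_iff:
  fixes a b :: "'a::real_vector"
  shows "lin_indep [a, b] \<longleftrightarrow> (\<forall>s t. s *\<^sub>R a + t *\<^sub>R b = 0 \<longrightarrow> s = 0 \<and> t = 0)"
proof
  assume "lin_indep [a, b]"
  then have ne: "a \<noteq> b" and ind: "independent {a, b}"
    by (auto simp: lin_indep_def)
  show "\<forall>s t. s *\<^sub>R a + t *\<^sub>R b = 0 \<longrightarrow> s = 0 \<and> t = 0"
  proof (intro allI impI)
    fix s t assume "s *\<^sub>R a + t *\<^sub>R b = 0"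
    then have "(\<Sum>x\<in>{a, b}. (if x = a then s else t) *\<^sub>R x) = 0"
      using ne by simp
    from independentD[OF ind _ _ this, of a] independentD[OF ind _ _ this, of b]
    show "s = 0 \<and> t = 0" using ne by auto
  qed
next
  assume *: "\<forall>s t. s *\<^sub>R a + t *\<^sub>R b = 0 \<longrightarrow> s = 0 \<and> t = 0"
  have "a \<noteq> b"
    \<comment> \<open>Equal vectors would satisfy a relation with coefficients 1 and -1.\<close>
    using *[rule_format, of 1 "-1"] by auto
  with * have "independent {a, b}"
    by (intro independent_if_scalars_zero) auto
  with \<open>a \<noteq> b\<close> show "lin_indep [a, b]"
    by (simp add: lin_indep_def)
qed

text \<open>A linear map carries any relation between \<open>a\<close> and \<open>b\<close> to the
  same relation between their images.\<close>

lemma lin_indep_2_linear_imp: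
  assumes "linear f" "lin_indep [f a, f b]"
  shows "lin_indep [a, b]"
  using assms(2) unfolding lin_indep_2_iff
  by (metis linear_0[OF assms(1)] linear_add[OF assms(1)] linear_scale[OF assms(1)])

lemma lin_indep_imp_cross3_nonzero:
  assumes "lin_indep [a, b]"
  shows "cross3 a b \<noteq> 0"
proof
  assume "cross3 a b = 0"
  then have "collinear {0, a, b}" by (simp add: cross_eq_0)
  then obtain c where "a = 0 \<or> b = 0 \<or> b = c *\<^sub>R a"
    by (auto simp: collinear_lemma)
  moreover note ind = assms[unfolded lin_indep_2_iff, rule_format]
  ultimately show False
    \<comment> \<open>One nontrivial relation for each of the three cases of collinearity.\<close>
    using ind[of 1 0] ind[of 0 1] ind[of c "-1"] by auto
qed

lemma bounded_bilinear_cross3: "bounded_bilinear cross3"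
  using bilinear_cross by (simp add: bilinear_conv_bounded_bilinear)

lemma linear_eq_matrix_sum:
  fixes A :: "real^3 \<Rightarrow> real^3"
  assumes "linear A"
  shows "A x = (\<Sum>i\<in>UNIV. x $ i *\<^sub>R A (axis i 1))"
  using linear_sum[OF assms, of "\<lambda>i. x $ i *\<^sub>R axis i 1" UNIV] basis_expansion[of x]
  by (simp add: linear_scale[OF assms] scalar_mult_eq_scaleR)

text \<open>Here \<open>a'\<close> and \<open>b'\<close> are the images of \<open>a\<close> and
  \<open>b\<close> under minus the transpose of \<open>A\<close>. The identity is the first-order
  part in \<open>s\<close> of (M a) x (M b) = det M * M^(-T) (a x b) for M = I - s A^T; it is
  checked componentwise.\<close>

lemma cross3_transpose_trace:
  fixes A :: "real^3 \<Rightarrow> real^3" and a b a' b' :: "real^3"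
  assumes A: "linear A"
    and a': "\<And>i. a' $ i = - (a \<bullet> A (axis i 1))" and b': "\<And>i. b' $ i = - (b \<bullet> A (axis i 1))"
  shows "cross3 a' b + cross3 a b' = A (cross3 a b) - (\<Sum>i\<in>UNIV. A (axis i 1) $ i) *\<^sub>R cross3 a b"
  unfolding linear_eq_matrix_sum[OF A, of "cross3 a b"]
  by (simp add: vec_eq_iff forall_3 cross_components sum_3 a' b' inner_vec_def algebra_simps)

subsection \<open>Conserved quantities\<close>

lemma smooth_spatial_gradient:
  assumes "smooth_on_space C T f"
  shows "smooth_on_space C T (spatial_gradient f)"
proof -
  let ?D = "\<lambda>i p. frechet_derivative f (at p) (axis i 1, 0)"
  have D: "smooth_on_space C T (?D i)" for i
    by (rule smooth_frechet_derivative[OF assms])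
  \<comment> \<open>In this form the closure properties for sums and scalar multiples apply.\<close>
  have eq: "spatial_gradient f = (\<lambda>p. \<Sum>i\<in>UNIV. ?D i p *\<^sub>R axis i 1)"
    by (auto simp: spatial_gradient_def vec_eq_iff axis_def if_distrib[of "\<lambda>x. _ * x"] cong: if_cong)
  show ?thesis
    using D unfolding smooth_on_space_def eq
    by (auto intro!: times_differentiable_sum
        bounded_bilinear.times_differentiable[OF bounded_bilinear_scaleR] times_differentiable_const)
qed

lemma smooth_material_field:
  assumes "smooth_on_space C T u"
  shows "smooth_on_space C T (material_field u)"
  using assms unfolding smooth_on_space_def material_field_def[abs_def]
  by (auto intro: times_differentiable_Pair times_differentiable_const)

lemma smooth_L_field:
  assumes "smooth_on_space C T \<rho>" "smooth_on_space C T q" "smooth_on_space C T \<eta>"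
    and "\<And>p. \<rho> p > 0"
  shows "smooth_on_space C T (L_field \<rho> q \<eta>)"
  using assms(1) smooth_spatial_gradient[OF assms(2)] smooth_spatial_gradient[OF assms(3)]
    less_imp_neq[OF assms(4), symmetric]
  unfolding smooth_on_space_def L_field_def[abs_def]
  by (auto intro!: times_differentiable_Pair times_differentiable_const times_differentiable_inverse
      bounded_bilinear.times_differentiable[OF bounded_bilinear_scaleR]
      bounded_bilinear.times_differentiable[OF bounded_bilinear_cross3])

lemma frechet_derivative_spatial:
  fixes f :: "spacetime \<Rightarrow> real"
  assumes "(f has_derivative frechet_derivative f (at p)) (at p)"
  shows "frechet_derivative f (at p) (x, 0) = spatial_gradient f p \<bullet> x"
proof -
  have "linear (\<lambda>x. frechet_derivative f (at p) (x, 0))"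
    by (rule linear_compose[OF _ has_derivative_linear[OF assms], unfolded o_def])
      (auto intro: linearI)
  from linear_sum[OF this, of "\<lambda>i. x $ i *\<^sub>R axis i 1" UNIV] linear_scale[OF this]
  have "frechet_derivative f (at p) (\<Sum>i\<in>UNIV. x $ i *\<^sub>R axis i 1, 0) = spatial_gradient f p \<bullet> x"
    by (simp add: spatial_gradient_def inner_vec_def mult.commute)
  then show ?thesis
    using basis_expansion[of x] by (simp add: scalar_mult_eq_scaleR)
qed

text \<open>Both values are triple products with a repeated factor.\<close>

lemma vf_apply_L_field:
  assumes "smooth_on_space C T q" "smooth_on_space C T \<eta>"
  shows "vf_apply (L_field \<rho> q \<eta>) q p = 0" "vf_apply (L_field \<rho> q \<eta>) \<eta> p = 0"
  using assms
  by (simp_all add: vf_apply_def L_field_def frechet_derivative_spatial smooth_has_derivative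
      dot_cross_self)

text \<open>The function \<open>vf_apply (material_field u) q\<close> vanishes identically, hence so
  does its derivative along the \<open>i\<close>-th spatial axis. One of the two terms of that
  derivative is the material derivative of the \<open>i\<close>-th component of the gradient, the
  other comes from differentiating \<open>u\<close>.\<close>

lemma material_derivative_spatial_gradient:
  assumes q: "smooth_on_space C T q" and u: "smooth_on_space C T u"
    and 0: "\<And>p. vf_apply (material_field u) q p = 0"
    and Q: "(spatial_gradient q has_derivative Q) (at p)"
  shows "Q (material_field u p) $ i = - (spatial_gradient q p \<bullet> frechet_derivative u (at p) (axis i 1, 0))"
proof -
  let ?D = "\<lambda>p. frechet_derivative q (at p) (axis i 1, 0)"
  have "((\<lambda>p. spatial_gradient q p $ i) has_derivative (\<lambda>h. Q h $ i)) (at p)"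
    by (rule bounded_linear.has_derivative[OF bounded_linear_vec_nth Q])
  from frechet_derivative_at[OF this] have D: "frechet_derivative ?D (at p) = (\<lambda>h. Q h $ i)"
    by (simp add: spatial_gradient_def)
  have "(material_field u has_derivative (\<lambda>h. (frechet_derivative u (at p) h, 0))) (at p)"
    unfolding material_field_def[abs_def]
    by (intro has_derivative_Pair smooth_has_derivative[OF u] has_derivative_const)
  moreover have "times_differentiable 2 q"
    using q by (simp add: smooth_on_space_def)
  ultimately have "(vf_apply (material_field u) q has_derivative
    (\<lambda>h. frechet_derivative q (at p) (frechet_derivative u (at p) h, 0) +
      frechet_derivative (\<lambda>x. frechet_derivative q (at x) h) (at p) (material_field u p))) (at p)"
    by (intro vf_apply_has_derivative)
  moreover have "vf_apply (material_field u) q = (\<lambda>p. 0)"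
    using 0 by (rule ext)
  then have "(vf_apply (material_field u) q has_derivative (\<lambda>h. 0)) (at p)"
    by simp
  ultimately have "(\<lambda>h. frechet_derivative q (at p) (frechet_derivative u (at p) h, 0) +
      frechet_derivative (\<lambda>x. frechet_derivative q (at x) h) (at p) (material_field u p)) = (\<lambda>h. 0)"
    by (rule has_derivative_unique)
  from fun_cong[OF this, of "(axis i 1, 0)"]
  have "frechet_derivative q (at p) (frechet_derivative u (at p) (axis i 1, 0), 0) +
      Q (material_field u p) $ i = 0"
    unfolding D .
  then show ?thesis
    unfolding frechet_derivative_spatial[OF smooth_has_derivative[OF q]] by linarith
qed

lemma commuting_material_L_field:
  assumes u: "smooth_on_space C T u" and \<rho>: "smooth_on_space C T \<rho>"
    and q: "smooth_on_space C T q" and \<eta>: "smooth_on_space C T \<eta>"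
    and pos: "\<And>p. \<rho> p > 0"
    and continuity: "\<And>p. vf_apply (material_field u) \<rho> p + \<rho> p * spatial_divergence u p = 0"
    and Dq: "\<And>p. vf_apply (material_field u) q p = 0"
    and D\<eta>: "\<And>p. vf_apply (material_field u) \<eta> p = 0"
  shows "commuting C T (material_field u) (L_field \<rho> q \<eta>)"
  unfolding commuting_def
proof (intro allI impI)
  fix f :: "spacetime \<Rightarrow> real" and p assume f: "smooth_on_space C T f"
  define X where "X = material_field u p"
  define a where "a = spatial_gradient q p"
  define b where "b = spatial_gradient \<eta> p"
  define u' where "u' = frechet_derivative u (at p)"
  define \<rho>' where "\<rho>' = frechet_derivative \<rho> (at p)"
  \<comment> \<open>The spatial Jacobian of \<open>u\<close>: its trace is the divergence, and it
    gives the derivative of \<open>u\<close> along \<open>L_field\<close>, whose time component is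
    zero.\<close>
  define A where "A = (\<lambda>x. u' (x, 0))"
  define a' where "a' = frechet_derivative (spatial_gradient q) (at p)"
  define b' where "b' = frechet_derivative (spatial_gradient \<eta>) (at p)"
  have Du: "(u has_derivative u') (at p)" and D\<rho>: "(\<rho> has_derivative \<rho>') (at p)"
    and Da: "(spatial_gradient q has_derivative a') (at p)"
    and Db: "(spatial_gradient \<eta> has_derivative b') (at p)"
    unfolding u'_def \<rho>'_def a'_def b'_def
    using u \<rho> smooth_spatial_gradient[OF q] smooth_spatial_gradient[OF \<eta>]
    by (auto intro: smooth_has_derivative)
  have DX: "(material_field u has_derivative (\<lambda>h. (u' h, 0))) (at p)"
    unfolding material_field_def[abs_def] by (intro has_derivative_Pair Du has_derivative_const)
  define r where "r = inverse (\<rho> p)"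
  have DL: "(L_field \<rho> q \<eta> has_derivative
      (\<lambda>h. (r *\<^sub>R (cross3 a (b' h) + cross3 (a' h) b) + (- (r * \<rho>' h * r)) *\<^sub>R cross3 a b, 0))) (at p)"
    unfolding L_field_def[abs_def] a_def b_def r_def
    using pos[of p]
    by (intro has_derivative_Pair has_derivative_const has_derivative_scaleR Deriv.has_derivative_inverse
        bounded_bilinear.FDERIV[OF bounded_bilinear_cross3] D\<rho> Da Db) auto
  have A: "linear A"
    unfolding A_def
    by (rule linear_compose[OF _ has_derivative_linear[OF Du], unfolded o_def])
      (auto intro: linearI)
  have "frechet_derivative (\<lambda>m. u m $ i) (at p) = (\<lambda>h. u' h $ i)" for i
    using frechet_derivative_at[OF bounded_linear.has_derivative[OF bounded_linear_vec_nth Du]]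
    by metis
  then have div: "spatial_divergence u p = (\<Sum>i\<in>UNIV. A (axis i 1) $ i)"
    by (simp add: spatial_divergence_def A_def)
  have "\<rho>' X = - \<rho> p * spatial_divergence u p"
    using continuity[of p] by (simp add: vf_apply_def X_def \<rho>'_def)
  \<comment> \<open>By the continuity equation, the material derivative of the inverse density is
    the inverse density times the divergence. This cancels the trace term of
    \<open>cross3_transpose_trace\<close>.\<close>
  then have rho: "- (r * \<rho>' X * r) = r * (\<Sum>i\<in>UNIV. A (axis i 1) $ i)"
    using pos[of p] by (simp add: div r_def)
  have "cross3 (a' X) b + cross3 a (b' X) = A (cross3 a b) - (\<Sum>i\<in>UNIV. A (axis i 1) $ i) *\<^sub>R cross3 a b"
    using A material_derivative_spatial_gradient[OF q u Dq Da]
      material_derivative_spatial_gradient[OF \<eta> u D\<eta> Db]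
    by (intro cross3_transpose_trace) (auto simp: X_def A_def a_def b_def u'_def)
  from arg_cong[OF this, of "scaleR r"] have "r *\<^sub>R (cross3 a (b' X) + cross3 (a' X) b) + (- (r * \<rho>' X * r)) *\<^sub>R cross3 a b = r *\<^sub>R A (cross3 a b)"
    unfolding rho by (simp add: algebra_simps)
  also have "\<dots> = u' (L_field \<rho> q \<eta> p)"
    using linear_scale[OF A, of r "cross3 a b"] by (simp add: A_def L_field_def a_def b_def r_def)
  \<comment> \<open>This is the spatial part of the commutator field in
    \<open>lie_bracket_eq\<close>; its time part is zero because both fields have constant time
    components.\<close>
  finally have "r *\<^sub>R (cross3 a (b' X) + cross3 (a' X) b) + (- (r * \<rho>' X * r)) *\<^sub>R cross3 a b
      - u' (L_field \<rho> q \<eta> p) = 0"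
    by simp
  moreover have "frechet_derivative f (at p) 0 = 0"
    by (rule linear_0[OF has_derivative_linear[OF smooth_has_derivative[OF f]]])
  moreover have "times_differentiable 2 f"
    using f by (simp add: smooth_on_space_def)
  ultimately show "lie_bracket (material_field u) (L_field \<rho> q \<eta>) f p = 0"
    using lie_bracket_eq[OF _ DX DL, of f] by (simp add: X_def)
qed

text \<open>The time components are 1 and 0, so the first coefficient of a relation vanishes; the
  second one then multiplies a nonzero cross product.\<close>

lemma lin_indep_material_L_field:
  assumes "lin_indep [spatial_gradient q p, spatial_gradient \<eta> p]" "\<rho> p > 0"
  shows "lin_indep [material_field u p, L_field \<rho> q \<eta> p]"
  using lin_indep_imp_cross3_nonzero[OF assms(1)] assms(2)
  unfolding lin_indep_2_iff[of "material_field u p"]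
  by (auto simp: material_field_def L_field_def zero_prod_def)

text \<open>The spatial gradient is the image of the full gradient under the projection
  \<open>fst\<close>, and linear maps reflect independence.\<close>

lemma lin_indep_full_gradient:
  assumes "smooth_on_space C T q" "smooth_on_space C T \<eta>"
    and "lin_indep [spatial_gradient q p, spatial_gradient \<eta> p]"
  shows "lin_indep [full_gradient q p, full_gradient \<eta> p]"
proof -
  have "fst (full_gradient f p) = spatial_gradient f p" if f: "smooth_on_space C T f" for f
  proof -
    have "full_gradient f p \<bullet> c = frechet_derivative f (at p) c" for c
      using linear_basis_expansion[OF has_derivative_linear[OF smooth_has_derivative[OF f]], of p c]
      by (simp add: full_gradient_def inner_sum_left inner_commute[of c] mult.commute)
    from this[of "(axis _ 1, 0)"] show ?thesis
      by (simp add: vec_eq_iff spatial_gradient_def inner_prod_def inner_axis)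
  qed
  with assms show ?thesis
    by (intro lin_indep_2_linear_imp[OF linear_fst]) auto
qed

theorem propositionB1:
  fixes C :: "spacetime set" and T :: "spacetime \<Rightarrow> real"
    and u :: "spacetime \<Rightarrow> real^3" and \<rho> q \<eta> :: "spacetime \<Rightarrow> real"
  assumes "periodic_coords C T"
    and "smooth_on_space C T u" and "smooth_on_space C T \<rho>"
    and "smooth_on_space C T q" and "smooth_on_space C T \<eta>"
    and "\<And>p. \<rho> p > 0"
    and "\<And>p. vf_apply (material_field u) \<rho> p + \<rho> p * spatial_divergence u p = 0"
    and "\<And>p. vf_apply (material_field u) q p = 0"
    and "\<And>p. vf_apply (material_field u) \<eta> p = 0"
  shows "smooth_on_space C T (L_field \<rho> q \<eta>) \<and>
    commuting C T (material_field u) (L_field \<rho> q \<eta>) \<and>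
    (negligible {p. \<not> lin_indep [spatial_gradient q p, spatial_gradient \<eta> p]} \<longrightarrow>
      integrable_system C T 2 2 [material_field u, L_field \<rho> q \<eta>] [q, \<eta>])"
proof -
  note L = smooth_L_field[OF assms(3-6)]
  note comm = commuting_material_L_field[OF assms(2-9)]
  have "integrable_system C T 2 2 [material_field u, L_field \<rho> q \<eta>] [q, \<eta>]"
    if neg: "negligible {p. \<not> lin_indep [spatial_gradient q p, spatial_gradient \<eta> p]}"
  proof -
    \<comment> \<open>Both exceptional sets lie inside the set where the spatial gradients are
      dependent.\<close>
    have "negligible {m. \<not> lin_indep [material_field u m, L_field \<rho> q \<eta> m]}"
      by (rule negligible_subset[OF neg]) (use lin_indep_material_L_field assms(6) in blast)
    moreover have "negligible {m. \<not> lin_indep [full_gradient q m, full_gradient \<eta> m]}"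
      by (rule negligible_subset[OF neg]) (use lin_indep_full_gradient assms(4,5) in blast)
    ultimately show ?thesis
      using L comm commuting_sym[OF comm] assms smooth_material_field
        vf_apply_L_field[OF assms(4,5)]
      unfolding integrable_system_def by (simp add: commuting_refl)
  qed
  with L comm show ?thesis by blast
qed

end
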